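(* Let $V$ be a vertex operator algebra, let $W$ be a weak $V$-module and let $n\ge 2$ be an integer. Put $Z_n(W)=W/C_n(W)$ and view $Z_n(W)^*$ as the subspace of $W^*$ consisting of the functionals vanishing on $C_n(W)$. Then $$Z_n(W)^*=\{\alpha\in W^*\;|\; v^*_m\alpha=0\ \text{ for all homogeneous } v\in V \text{ and all integers } m\ge 2\,\mathrm{wt}\,v+n-2\}.$$ In particular, $Z_n(W)^*\subseteq D(W)$.
   Context: All vector spaces are over $\mathbb{C}$. A vertex operator algebra $V=\coprod_{n\in\mathbb{Z}}V_{(n)}$ is meant in the standard sense of Frenkel–Huang–Lepowsky: $Y(v,x)=\sum_{n\in\mathbb{Z}}v_nx^{-n-1}$, vacuum $\mathbf{1}$, $Y(\omega,x)=\sum_n L(n)x^{-n-2}$, $V_{(n)}$ is the $L(0)$-eigenspace of eigenvalue $n$ (homogeneous $v\in V_{(n)}$ has $\mathrm{wt}\,v=n$), $\dim V_{(n)}<\infty$, $V_{(n)}=0$ for $n$ sufficiently negative. A weak $V$-module is a vector space $W$ with a linear map $v\mapsto Y(v,x)=\sum_n v_nx^{-n-1}\in(\mathrm{End}\,W)[[x,x^{-1}]]$ satisfying $Y(v,x)w\in W((x))$, $Y(\mathbf{1},x)=\mathrm{id}_W$ and the Jacobi identity (no grading required). $C_n(W)$ (for $n\ge 2$) is the linear span of all $v_{-n}w$ with $v\in V$, $w\in W$. For $v\in V$ and $\alpha\in W^*$ (full linear dual) define $Y^*(v,x)\alpha=\sum_{n\in\mathbb{Z}}(v^*_n\alpha)x^{-n-1}$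 by $$\langle Y^*(v,x)\alpha,w\rangle=\left\langle\alpha,Y\left(e^{xL(1)}(-x^{-2})^{L(0)}v,x^{-1}\right)w\right\rangle,\quad w\in W.$$ $D(W)$ is the subspace of all $\alpha\in W^*$ such that $Y^*(v,x)\alpha\in W^*((x))$ for every $v\in V$, i.e. $v^*_n\alpha=0$ for $n$ sufficiently large (depending on $v$). *)

theory Defs
  imports Complex_Main "HOL-Library.Groups_Big_Fun"
begin

text \<open>
  Complex vector spaces are types of class \<open>ab_group_add\<close> with a scalar multiplication over
  \<^typ>\<open>complex\<close>. A vertex operator map \<open>Y(v,x) = \<Sum>n. v\<^sub>n x^(-n-1)\<close> is encoded by its modes:
  \<open>Y v n w\<close> is \<open>v\<^sub>n w\<close>. Formal sums are \<^const>\<open>Sum_any\<close>, which is the sum over the support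
  if this is finite (and 0 otherwise); all sums below have finite support, for the
  modes of a weak module over a vertex operator algebra.
\<close>

text \<open>
  The Jacobi identity
    \<open>x0^(-1) delta((x1-x2)/x0) Y(u,x1) Y(v,x2) w
       - x0^(-1) delta((x2-x1)/(-x0)) Y(v,x2) Y(u,x1) w
       = x2^(-1) delta((x1-x0)/x2) Y(Y(u,x0)v,x2) w\<close>,
  read off at the monomial \<open>x0^(-r-1) x1^(-p-1) x2^(-q-1)\<close>. Here
  \<open>delta(x) = \<Sum>n. x^n\<close> and binomials are expanded in nonnegative powers of the second
  variable; on the right-hand side \<open>(-1)^i ((i-p-1) gchoose i) = (p gchoose i)\<close>.
  \<open>YV\<close> acts on the algebra and \<open>YW\<close> on the module.
\<close>
definition jacobi_identity ::
  "(complex \<Rightarrow> 'w \<Rightarrow> 'w) \<Rightarrow> ('v \<Rightarrow> int \<Rightarrow> 'v \<Rightarrow> 'v) \<Rightarrow>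
   ('v \<Rightarrow> int \<Rightarrow> 'w::ab_group_add \<Rightarrow> 'w) \<Rightarrow> bool" where
  "jacobi_identity sW YV YW \<longleftrightarrow>
     (\<forall>u v w p q r.
        Sum_any (\<lambda>i::nat. sW ((-1) ^ i * (of_int r gchoose i))
                   (YW u (p + r - int i) (YW v (q + int i) w)))
      - Sum_any (\<lambda>i::nat. sW ((-1) powi r * (-1) ^ i * (of_int r gchoose i))
                   (YW v (q + r - int i) (YW u (p + int i) w)))
      = Sum_any (\<lambda>i::nat. sW (of_int p gchoose i)
                   (YW (YV u (r + int i) v) (p + q - int i) w)))"

text \<open>\<open>L(n)\<close>, from \<open>Y(\<omega>,x) = \<Sum>n. L(n) x^(-n-2)\<close>.\<close>
definition vir :: "('v \<Rightarrow> int \<Rightarrow> 'w \<Rightarrow> 'w) \<Rightarrow> 'v \<Rightarrow> int \<Rightarrow> 'w \<Rightarrow> 'w" where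
  "vir Y \<omega> n = Y \<omega> (n + 1)"

definition weight_space ::
  "(complex \<Rightarrow> 'v \<Rightarrow> 'v) \<Rightarrow> ('v \<Rightarrow> int \<Rightarrow> 'v \<Rightarrow> 'v) \<Rightarrow> 'v \<Rightarrow> int \<Rightarrow> 'v set" where
  "weight_space sV Y \<omega> n = {v. vir Y \<omega> 0 v = sV (of_int n) v}"

definition homogeneous_decomposition ::
  "(complex \<Rightarrow> 'v \<Rightarrow> 'v) \<Rightarrow> ('v \<Rightarrow> int \<Rightarrow> 'v \<Rightarrow> 'v) \<Rightarrow> 'v \<Rightarrow>
   'v::ab_group_add \<Rightarrow> (int \<Rightarrow> 'v) \<Rightarrow> bool" where
  "homogeneous_decomposition sV Y \<omega> v f \<longleftrightarrow>
     (\<forall>n. f n \<in> weight_space sV Y \<omega> n) \<and> finite {n. f n \<noteq> 0} \<and> Sum_any f = v"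

text \<open>
  The axiom \<open>grading\<close> says that \<open>V\<close> is the direct sum of its weight spaces.
  \<open>c\<close> is the central charge. \<open>finite_dim\<close> is not phrased with the library's \<open>dim\<close>, which is
  0 on infinite-dimensional subspaces.
\<close>
locale vertex_operator_algebra = V: vector_space sV
  for sV :: "complex \<Rightarrow> 'v::ab_group_add \<Rightarrow> 'v"
  and Y :: "'v \<Rightarrow> int \<Rightarrow> 'v \<Rightarrow> 'v"
  and vac \<omega> :: 'v
  and c :: complex +
  assumes linear_left: "Vector_Spaces.linear sV sV (\<lambda>u. Y u n v)"
    and linear_right: "Vector_Spaces.linear sV sV (\<lambda>v. Y u n v)"
    and truncation: "\<exists>N. \<forall>n\<ge>N. Y u n v = 0"
    and vacuum: "Y vac n v = (if n = -1 then v else 0)"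
    and creation: "Y v (-1) vac = v" "n \<ge> 0 \<Longrightarrow> Y v n vac = 0"
    and jacobi: "jacobi_identity sV Y Y"
    and virasoro:
      "vir Y \<omega> m (vir Y \<omega> n v) - vir Y \<omega> n (vir Y \<omega> m v) =
         sV (of_int (m - n)) (vir Y \<omega> (m + n) v)
       + (if m + n = 0 then sV (of_int (m ^ 3 - m) / 12 * c) v else 0)"
    and L_minus_1_derivative: "Y (vir Y \<omega> (-1) v) n u = sV (of_int (- n)) (Y v (n - 1) u)"
    and grading: "\<exists>!f. homogeneous_decomposition sV Y \<omega> v f"
    and finite_dim: "\<exists>B. finite B \<and> weight_space sV Y \<omega> n \<subseteq> V.span B"
    and lower_bounded: "\<exists>N. \<forall>n<N. weight_space sV Y \<omega> n = {0}"
    and vacuum_weight: "vac \<in> weight_space sV Y \<omega> 0"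
    and conformal_weight: "\<omega> \<in> weight_space sV Y \<omega> 2"

locale weak_module = vertex_operator_algebra sV Y vac \<omega> c + W: vector_space sW
  for sV :: "complex \<Rightarrow> 'v::ab_group_add \<Rightarrow> 'v"
  and Y :: "'v \<Rightarrow> int \<Rightarrow> 'v \<Rightarrow> 'v"
  and vac \<omega> :: 'v
  and c :: complex
  and sW :: "complex \<Rightarrow> 'w::ab_group_add \<Rightarrow> 'w"
  and YW :: "'v \<Rightarrow> int \<Rightarrow> 'w \<Rightarrow> 'w" +
  assumes module_linear_left: "Vector_Spaces.linear sV sW (\<lambda>v. YW v n w)"
    and module_linear_right: "Vector_Spaces.linear sW sW (\<lambda>w. YW v n w)"
    and module_truncation: "\<exists>N. \<forall>n\<ge>N. YW v n w = 0"
    and module_vacuum: "YW vac n w = (if n = -1 then w else 0)"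
    and module_jacobi: "jacobi_identity sW Y YW"

definition C_space ::
  "(complex \<Rightarrow> 'w \<Rightarrow> 'w) \<Rightarrow> ('v \<Rightarrow> int \<Rightarrow> 'w \<Rightarrow> 'w) \<Rightarrow> int \<Rightarrow> 'w::ab_group_add set" where
  "C_space sW YW n = module.span sW {YW v (- n) w | v w. True}"

definition full_dual :: "(complex \<Rightarrow> 'w \<Rightarrow> 'w) \<Rightarrow> ('w::ab_group_add \<Rightarrow> complex) set" where
  "full_dual sW = {\<alpha>. Vector_Spaces.linear sW (*) \<alpha>}"

text \<open>\<open>Z\<^sub>n(W)\<^sup>*\<close>, the dual of \<open>W / C\<^sub>n(W)\<close>, viewed as a subspace of \<open>W\<^sup>*\<close>.\<close>
definition Z_dual ::
  "(complex \<Rightarrow> 'w \<Rightarrow> 'w) \<Rightarrow> ('v \<Rightarrow> int \<Rightarrow> 'w \<Rightarrow> 'w) \<Rightarrow> int \<Rightarrow>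
   ('w::ab_group_add \<Rightarrow> complex) set" where
  "Z_dual sW YW n = {\<alpha> \<in> full_dual sW. \<forall>w \<in> C_space sW YW n. \<alpha> w = 0}"

text \<open>
  Laurent polynomials over \<open>V\<close> are coefficient functions: \<open>f k\<close> is the coefficient of \<open>x^k\<close>.
  \<open>(-x^(-2))^L(0)\<close> multiplies the component of weight \<open>h\<close> by \<open>(-1)^h x^(-2h)\<close>.
\<close>
definition homogeneous_component ::
  "(complex \<Rightarrow> 'v \<Rightarrow> 'v) \<Rightarrow> ('v \<Rightarrow> int \<Rightarrow> 'v \<Rightarrow> 'v) \<Rightarrow> 'v \<Rightarrow>
   int \<Rightarrow> 'v::ab_group_add \<Rightarrow> 'v" where
  "homogeneous_component sV Y \<omega> h v = (THE f. homogeneous_decomposition sV Y \<omega> v f) h"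

definition pow_L0 ::
  "(complex \<Rightarrow> 'v \<Rightarrow> 'v) \<Rightarrow> ('v \<Rightarrow> int \<Rightarrow> 'v \<Rightarrow> 'v) \<Rightarrow> 'v \<Rightarrow>
   'v::ab_group_add \<Rightarrow> int \<Rightarrow> 'v" where
  "pow_L0 sV Y \<omega> v k =
     (if even k
      then let h = - (k div 2) in sV ((-1) powi h) (homogeneous_component sV Y \<omega> h v)
      else 0)"

text \<open>\<open>e^(x L(1)) f(x)\<close>\<close>
definition exp_L1 ::
  "(complex \<Rightarrow> 'v \<Rightarrow> 'v) \<Rightarrow> ('v \<Rightarrow> int \<Rightarrow> 'v \<Rightarrow> 'v) \<Rightarrow> 'v \<Rightarrow>
   (int \<Rightarrow> 'v::ab_group_add) \<Rightarrow> int \<Rightarrow> 'v" where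
  "exp_L1 sV Y \<omega> f k =
     Sum_any (\<lambda>i::nat. sV (1 / fact i) ((vir Y \<omega> 1 ^^ i) (f (k - int i))))"

text \<open>
  The coefficient of \<open>x^k\<close> in \<open>Y(f(x), x^(-1)) w = \<Sum>j n. (f j)\<^sub>n w x^(j+n+1)\<close>.
\<close>
definition Y_inverse_coeff ::
  "('v \<Rightarrow> int \<Rightarrow> 'w \<Rightarrow> 'w::ab_group_add) \<Rightarrow> (int \<Rightarrow> 'v) \<Rightarrow> 'w \<Rightarrow> int \<Rightarrow> 'w" where
  "Y_inverse_coeff YW f w k = Sum_any (\<lambda>j. YW (f j) (k - j - 1) w)"

text \<open>\<open>v\<^sup>*\<^sub>m \<alpha>\<close>, the coefficient of \<open>x^(-m-1)\<close> in \<open>Y\<^sup>*(v,x) \<alpha>\<close>.\<close>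
definition star_mode ::
  "(complex \<Rightarrow> 'v \<Rightarrow> 'v) \<Rightarrow> ('v \<Rightarrow> int \<Rightarrow> 'v \<Rightarrow> 'v) \<Rightarrow> 'v \<Rightarrow>
   ('v::ab_group_add \<Rightarrow> int \<Rightarrow> 'w \<Rightarrow> 'w::ab_group_add) \<Rightarrow>
   'v \<Rightarrow> int \<Rightarrow> ('w \<Rightarrow> complex) \<Rightarrow> 'w \<Rightarrow> complex" where
  "star_mode sV Y \<omega> YW v m \<alpha> =
     (\<lambda>w. \<alpha> (Y_inverse_coeff YW (exp_L1 sV Y \<omega> (pow_L0 sV Y \<omega> v)) w (- m - 1)))"

definition D_space ::
  "(complex \<Rightarrow> 'v \<Rightarrow> 'v) \<Rightarrow> ('v \<Rightarrow> int \<Rightarrow> 'v \<Rightarrow> 'v) \<Rightarrow> 'v \<Rightarrow>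
   (complex \<Rightarrow> 'w \<Rightarrow> 'w) \<Rightarrow> ('v::ab_group_add \<Rightarrow> int \<Rightarrow> 'w \<Rightarrow> 'w) \<Rightarrow>
   ('w::ab_group_add \<Rightarrow> complex) set" where
  "D_space sV Y \<omega> sW YW =
     {\<alpha> \<in> full_dual sW. \<forall>v. \<exists>N. \<forall>m\<ge>N. star_mode sV Y \<omega> YW v m \<alpha> = (\<lambda>w. 0)}"

end

theory Submission imports Defs begin

text \<open>
  The modes of index at most \<open>-n\<close> all map \<open>W\<close> into \<open>C\<^sub>n(W)\<close>, because \<open>(L(-1)v)\<^sub>-\<^sub>k = k v\<^sub>-\<^sub>k\<^sub>-\<^sub>1\<close>.
  For \<open>v\<close> of weight \<open>h\<close> one has
  \<open>\<langle>v\<^sup>*\<^sub>m \<alpha>, w\<rangle> = (-1)^h \<Sum>i. \<langle>\<alpha>, (L(1)^i v)\<^sub>p w\<rangle> / i!\<close> with \<open>p = 2h - m - 2 - i\<close>, so only modes of index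
  at most \<open>-n\<close> occur when \<open>m \<ge> 2h + n - 2\<close>; this gives one inclusion. For the converse, \<open>L(1)\<close>
  lowers the weight, so by induction on \<open>h\<close> (the weights are bounded below) all terms
  with \<open>i > 0\<close> vanish and what remains is \<open>\<langle>\<alpha>, v\<^sub>-\<^sub>k w\<rangle> = 0\<close> for \<open>k \<ge> n\<close>.
\<close>

section \<open>Formal sums, linear maps and a binomial coefficient\<close>

lemma (in module) subspace_Sum_any:
  assumes "subspace S" "\<And>x. f x \<in> S"
  shows "Sum_any f \<in> S"
  \<comment> \<open>For infinite support \<open>Sum_any f\<close> is 0, which lies in the subspace
    as well.\<close>
  unfolding Sum_any.expand_set using assms by (intro subspace_sum) auto

lemma Sum_any_single:
  assumes "\<And>x. x \<noteq> a \<Longrightarrow> f x = 0"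
  shows "Sum_any f = f a"
proof -
  have "Sum_any f = sum f {a}"
    by (rule Sum_any.expand_superset) (use assms in auto)
  then show ?thesis by simp
qed

lemma linear_Sum_any:
  assumes f: "Vector_Spaces.linear s1 s2 f" and fin: "finite {x. g x \<noteq> 0}"
  shows "f (Sum_any g) = Sum_any (\<lambda>x. f (g x))"
proof -
  interpret Vector_Spaces.linear s1 s2 f by fact
  have "f (Sum_any g) = (\<Sum>x | g x \<noteq> 0. f (g x))"
    by (simp add: Sum_any.expand_set sum)
  \<comment> \<open>The support may shrink under \<open>f\<close>, so the sum runs over the support
    of \<open>g\<close> as a finite superset.\<close>
  also have "\<dots> = Sum_any (\<lambda>x. f (g x))"
    by (rule Sum_any.expand_superset[symmetric]) (use fin zero in auto)
  finally show ?thesis .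
qed

lemma linear_zero: "Vector_Spaces.linear s1 s2 f \<Longrightarrow> f 0 = 0"
  by (meson Vector_Spaces.linear.axioms(3) module_hom.zero)

lemma linear_scale: "Vector_Spaces.linear s1 s2 f \<Longrightarrow> f (s1 r x) = s2 r (f x)"
  by (meson Vector_Spaces.linear.axioms(3) module_hom.scale)

lemma linear_add: "Vector_Spaces.linear s1 s2 f \<Longrightarrow> f (x + y) = f x + f y"
  by (meson Vector_Spaces.linear.axioms(3) module_hom.add)

text \<open>Upper negation turns the coefficient into (i+1 choose i). It evaluates the expansion in
  the Jacobi identity at r = -2.\<close>

lemma gbinomial_minus_two: "(-1) ^ i * (-2 gchoose i) = (of_nat (Suc i) :: 'a::field_char_0)"
  by (simp add: gbinomial_minus binomial_gbinomial[symmetric] flip: of_nat_Suc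
      power_mult_distrib mult.assoc)

section \<open>Weights and the Laurent polynomial e^(x L(1)) (-x^(-2))^L(0) v\<close>

context vertex_operator_algebra
begin

abbreviation "wt_space \<equiv> weight_space sV Y \<omega>"

lemma linear_vir: "Vector_Spaces.linear sV sV (vir Y \<omega> k)"
  unfolding vir_def using linear_right by simp

lemma subspace_weight_space: "V.subspace (wt_space h)"
  unfolding V.subspace_def weight_space_def
  by (auto simp: linear_zero[OF linear_vir] linear_add[OF linear_vir]
      linear_scale[OF linear_vir] V.scale_right_distrib V.scale_left_commute)

text \<open>This is [L(0), L(1)] = -L(1); the central term is absent since 0 + 1 is nonzero.\<close>

lemma vir_one_weight:
  assumes "v \<in> wt_space h"
  shows "vir Y \<omega> 1 v \<in> wt_space (h - 1)"
proof -
  have "vir Y \<omega> 0 (vir Y \<omega> 1 v) - vir Y \<omega> 1 (vir Y \<omega> 0 v) = sV (-1) (vir Y \<omega> 1 v)"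
    using virasoro[of 0 1 v] by simp
  moreover have "vir Y \<omega> 1 (vir Y \<omega> 0 v) = sV (of_int h) (vir Y \<omega> 1 v)"
    using assms by (simp add: weight_space_def linear_scale[OF linear_vir])
  ultimately show ?thesis
    by (simp add: weight_space_def V.scale_left_diff_distrib algebra_simps)
qed

lemma vir_one_funpow_weight:
  assumes "v \<in> wt_space h"
  shows "(vir Y \<omega> 1 ^^ i) v \<in> wt_space (h - int i)"
proof (induction i)
  case (Suc i)
  then show ?case using vir_one_weight[OF Suc] by (simp add: algebra_simps)
qed (use assms in simp)

lemma vir_one_funpow_zero: "(vir Y \<omega> 1 ^^ i) 0 = 0"
  by (induction i) (simp_all add: linear_zero[OF linear_vir])

lemma homogeneous_decomposition_component:
  "homogeneous_decomposition sV Y \<omega> v (\<lambda>h. homogeneous_component sV Y \<omega> h v)"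
  unfolding homogeneous_component_def by (rule theI'[OF grading])

text \<open>The family concentrated at \<open>h\<close> is a decomposition of \<open>v\<close>,
  hence the only one.\<close>

lemma homogeneous_component_weight:
  assumes "v \<in> wt_space h"
  shows "homogeneous_component sV Y \<omega> k v = (if k = h then v else 0)"
proof -
  let ?f = "\<lambda>k. if k = h then v else 0"
  have "finite {k. ?f k \<noteq> 0}"
    by (rule finite_subset[of _ "{h}"]) auto
  moreover have "Sum_any ?f = v"
    using Sum_any_single[of h ?f] by simp
  ultimately have "homogeneous_decomposition sV Y \<omega> v ?f"
    using assms V.subspace_0[OF subspace_weight_space]
    unfolding homogeneous_decomposition_def by auto
  then show ?thesis
    unfolding homogeneous_component_def by (simp add: the1_equality[OF grading])
qed

lemma pow_L0_weight:
  assumes "v \<in> wt_space h"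
  shows "pow_L0 sV Y \<omega> v k = (if k = - 2 * h then sV ((-1) powi h) v else 0)"
  unfolding pow_L0_def Let_def homogeneous_component_weight[OF assms] by auto

text \<open>At most the term i = j + 2h contributes to the coefficient of x^j. It is (-1)^h L(1)^i v
  / i!, of weight h - i = -h - j.\<close>

lemma exp_L1_pow_L0_weight:
  assumes v: "v \<in> wt_space h"
  defines "f \<equiv> exp_L1 sV Y \<omega> (pow_L0 sV Y \<omega> v)"
  shows "f j \<in> wt_space (- h - j)" and "f (- 2 * h) = sV ((-1) powi h) v"
proof -
  let ?g = "\<lambda>j i. sV (1 / fact i) ((vir Y \<omega> 1 ^^ i) (pow_L0 sV Y \<omega> v (j - int i)))"
  have f: "f j = Sum_any (?g j)" for j
    by (simp add: f_def exp_L1_def)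
  have "?g j i \<in> wt_space (- h - j)" for i
  proof (cases "j - int i = - 2 * h")
    case True
    then have "h - int i = - h - j" by simp
    then have "(vir Y \<omega> 1 ^^ i) (sV ((-1) powi h) v) \<in> wt_space (- h - j)"
      using vir_one_funpow_weight[OF V.subspace_scale[OF subspace_weight_space v]] by metis
    then show ?thesis
      using True V.subspace_scale[OF subspace_weight_space] by (simp add: pow_L0_weight[OF v])
  next
    case False
    then show ?thesis
      by (simp add: pow_L0_weight[OF v] vir_one_funpow_zero
          V.subspace_0[OF subspace_weight_space])
  qed
  then show "f j \<in> wt_space (- h - j)"
    unfolding f by (intro V.subspace_Sum_any subspace_weight_space)
  have "Sum_any (?g (- 2 * h)) = ?g (- 2 * h) 0"
    by (rule Sum_any_single) (simp add: pow_L0_weight[OF v] vir_one_funpow_zero)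
  then show "f (- 2 * h) = sV ((-1) powi h) v"
    unfolding f by (simp add: pow_L0_weight[OF v])
qed

text \<open>A component of weight at most \<open>H\<close> enters with power at least -2H, and e^(x
  L(1)) only raises powers.\<close>

lemma exp_L1_pow_L0_eq_0:
  assumes "\<And>h. homogeneous_component sV Y \<omega> h v \<noteq> 0 \<Longrightarrow> h \<le> H" and "j < - 2 * H"
  shows "exp_L1 sV Y \<omega> (pow_L0 sV Y \<omega> v) j = 0"
proof -
  have "pow_L0 sV Y \<omega> v (j - int i) = 0" for i
  proof (cases "even (j - int i)")
    case True
    then obtain b where b: "j - int i = 2 * b" by blast
    then have "\<not> - b \<le> H" using assms(2) by linarith
    then have "homogeneous_component sV Y \<omega> (- b) v = 0" using assms(1) by blast
    then show ?thesis by (simp add: pow_L0_def b)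
  qed (simp add: pow_L0_def)
  then show ?thesis by (simp add: exp_L1_def vir_one_funpow_zero)
qed

end

section \<open>Modes of the module and the functionals they annihilate\<close>

context weak_module
begin

text \<open>
  The Jacobi identity at \<open>(p,q,r) = (0,m,-2)\<close> with the vacuum as second vector; for \<open>m < 0\<close> only
  the first of the three sums has a term with a nonzero vacuum mode.
\<close>
lemma module_L_minus_1:
  assumes "m < 0"
  shows "YW (vir Y \<omega> (-1) v) m w = sW (of_int (- m)) (YW v (m - 1) w)"
proof -
  \<comment> \<open>Both are the (-1)-mode of L(-1)v applied to the vacuum, by creation and the
    derivative property.\<close>
  have v: "vir Y \<omega> (-1) v = Y v (-2) vac"
    using creation(1)[of "vir Y \<omega> (-1) v"] L_minus_1_derivative[of v "-1" vac] by simp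
  have zeroW: "YW u k 0 = 0" for u k by (rule linear_zero[OF module_linear_right])
  let ?A = "\<lambda>i::nat. sW ((-1) ^ i * (of_int (-2) gchoose i))
                   (YW v (0 + -2 - int i) (YW vac (m + int i) w))"
  let ?B = "\<lambda>i::nat. sW ((-1) powi (-2) * (-1) ^ i * (of_int (-2) gchoose i))
                   (YW vac (m + -2 - int i) (YW v (0 + int i) w))"
  let ?C = "\<lambda>i::nat. sW (of_int 0 gchoose i)
                   (YW (Y v (-2 + int i) vac) (0 + m - int i) w)"
  have "Sum_any ?A - Sum_any ?B = Sum_any ?C"
    using module_jacobi unfolding jacobi_identity_def by blast
  \<comment> \<open>The vacuum mode \<open>m + i\<close> has to be -1; since \<open>m < 0\<close>,
    this index i is nonnegative.\<close>
  moreover have "Sum_any ?A = ?A (nat (- m - 1))"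
    by (rule Sum_any_single) (auto simp: module_vacuum zeroW)
  moreover have "?A (nat (- m - 1)) = sW (of_int (- m)) (YW v (m - 1) w)"
  proof -
    have "(-1) ^ nat (- m - 1) * (of_int (-2) gchoose nat (- m - 1)) = (of_int (- m) :: complex)"
      using gbinomial_minus_two[of "nat (- m - 1)", where 'a = complex] assms
      by (simp add: of_nat_nat)
    then show ?thesis using assms by (simp add: module_vacuum algebra_simps)
  qed
  moreover have "Sum_any ?B = 0"
    using assms by (simp add: module_vacuum)
  moreover have "Sum_any ?C = ?C 0"
    by (rule Sum_any_single) (simp add: gbinomial_0_left)
  ultimately show ?thesis by (simp add: v)
qed

lemma mode_in_C_space:
  assumes "n \<ge> 1" "k \<ge> n"
  shows "YW v (- k) w \<in> C_space sW YW n"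
  using assms(2)
proof (induction k arbitrary: v w rule: int_ge_induct)
  case base
  show ?case unfolding C_space_def by (rule W.span_base) auto
next
  case (step k)
  \<comment> \<open>The induction hypothesis is applied to L(-1)v in place of v; division by
    \<open>k\<close> is possible as k \<ge> n \<ge> 1.\<close>
  have "sW (1 / of_int k) (YW (vir Y \<omega> (-1) v) (- k) w) \<in> C_space sW YW n"
    using step.IH unfolding C_space_def by (intro W.span_scale)
  moreover have "sW (1 / of_int k) (YW (vir Y \<omega> (-1) v) (- k) w) = YW v (- (k + 1)) w"
    using module_L_minus_1[of "- k" v w] step.hyps assms(1) by (simp add: minus_diff_commute)
  ultimately show ?case by simp
qed

text \<open>The bound \<open>H\<close> on the weights in \<open>v\<close> serves two uses: H = h for
  homogeneous vectors, and the largest occurring weight for membership in D(W).\<close>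

lemma star_mode_Z_dual:
  assumes n: "n \<ge> 1" and \<alpha>: "\<alpha> \<in> Z_dual sW YW n"
    and H: "\<And>h. homogeneous_component sV Y \<omega> h v \<noteq> 0 \<Longrightarrow> h \<le> H"
    and m: "m \<ge> 2 * H + n - 2"
  shows "star_mode sV Y \<omega> YW v m \<alpha> = (\<lambda>w. 0)"
proof
  fix w
  let ?f = "exp_L1 sV Y \<omega> (pow_L0 sV Y \<omega> v)"
  have "YW (?f j) (- m - 1 - j - 1) w \<in> C_space sW YW n" for j
  proof (cases "j < - 2 * H")
    case True
    then have "?f j = 0" by (intro exp_L1_pow_L0_eq_0[of v H] H)
    then show ?thesis
      by (simp add: linear_zero[OF module_linear_left] C_space_def W.span_zero)
  next
    case False
    \<comment> \<open>From j \<ge> -2H and the bound on m follows m + j + 2 \<ge> n.\<close>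
    moreover have "- m - 1 - j - 1 = - (m + j + 2)" by simp
    ultimately show ?thesis
      using mode_in_C_space[OF n, of "m + j + 2" "?f j" w] m by simp
  qed
  then have "Y_inverse_coeff YW ?f w (- m - 1) \<in> C_space sW YW n"
    unfolding Y_inverse_coeff_def C_space_def by (intro W.subspace_Sum_any W.subspace_span)
  then show "star_mode sV Y \<omega> YW v m \<alpha> w = 0"
    using \<alpha> by (simp add: star_mode_def Z_dual_def)
qed

lemma Z_dual_subset_D_space:
  assumes "n \<ge> 1"
  shows "Z_dual sW YW n \<subseteq> D_space sV Y \<omega> sW YW"
proof
  fix \<alpha> assume \<alpha>: "\<alpha> \<in> Z_dual sW YW n"
  have "\<exists>N. \<forall>m\<ge>N. star_mode sV Y \<omega> YW v m \<alpha> = (\<lambda>w. 0)" for v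
  proof -
    have "finite {h. homogeneous_component sV Y \<omega> h v \<noteq> 0}"
      using homogeneous_decomposition_component[of v]
      by (simp add: homogeneous_decomposition_def)
    then obtain H where "\<And>h. homogeneous_component sV Y \<omega> h v \<noteq> 0 \<Longrightarrow> h \<le> H"
      by (meson Max_ge mem_Collect_eq)
    then show ?thesis using star_mode_Z_dual[OF assms \<alpha>] by blast
  qed
  then show "\<alpha> \<in> D_space sV Y \<omega> sW YW"
    using \<alpha> by (simp add: D_space_def Z_dual_def)
qed

lemma annihilates_homogeneous_modes:
  assumes \<alpha>: "Vector_Spaces.linear sW (*) \<alpha>"
    and star: "\<And>h v m. v \<in> wt_space h \<Longrightarrow> m \<ge> 2 * h + n - 2 \<Longrightarrow>
      star_mode sV Y \<omega> YW v m \<alpha> = (\<lambda>w. 0)"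
    and "v \<in> wt_space h" "k \<ge> n"
  shows "\<alpha> (YW v (- k) w) = 0"
proof -
  obtain N where N: "\<And>h. h < N \<Longrightarrow> wt_space h = {0}"
    using lower_bounded by blast
  show ?thesis
    using assms(3,4)
  \<comment> \<open>The \<open>+ 1\<close> makes the measure positive at h = N, so it still drops
    when the weight falls below \<open>N\<close>. Also \<open>k\<close> varies, as lower weights
    come with larger \<open>k\<close>.\<close>
  proof (induction "nat (h - N + 1)" arbitrary: h v k rule: less_induct)
    case less
    show ?case
    proof (cases "h < N")
      case True
      then have "v = 0" using N less.prems(1) by blast
      then show ?thesis
        by (simp add: linear_zero[OF module_linear_left] linear_zero[OF \<alpha>])
    next
      case False
      let ?f = "exp_L1 sV Y \<omega> (pow_L0 sV Y \<omega> v)"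
      \<comment> \<open>Chosen so that the leading power j = -2h is paired with the mode of index
        -k.\<close>
      let ?m = "2 * h + k - 2"
      let ?g = "\<lambda>j. YW (?f j) (- ?m - 1 - j - 1) w"
      have f_low: "?f j = 0" if "j < - 2 * h" for j
        by (rule exp_L1_pow_L0_eq_0[OF _ that])
          (simp add: homogeneous_component_weight[OF less.prems(1)] split: if_splits)
      have f_high: "?f j = 0" if "j > - h - N" for j
        using exp_L1_pow_L0_weight(1)[OF less.prems(1), of j] N[of "- h - j"] that by simp
      \<comment> \<open>Finite support is what allows \<alpha> to be moved inside the formal
        sum.\<close>
      have "j \<in> {- 2 * h .. - h - N}" if "?g j \<noteq> 0" for j
        using that f_low[of j] f_high[of j]
        by (force simp: linear_zero[OF module_linear_left])
      then have fin: "finite {j. ?g j \<noteq> 0}"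
        by (intro finite_subset[OF _ finite_atLeastAtMost_int[of "- 2 * h" "- h - N"]]) blast
      have vanish: "\<alpha> (?g j) = 0" if "j \<noteq> - 2 * h" for j
      proof (cases "j < - 2 * h")
        case True
        then show ?thesis
          using f_low by (simp add: linear_zero[OF module_linear_left] linear_zero[OF \<alpha>])
      next
        case j: False
        \<comment> \<open>With i = j + 2h > 0, the coefficient has smaller weight h - i and mode
          index -(k + i).\<close>
        have "\<alpha> (YW (?f j) (- (k + (j + 2 * h))) w) = 0"
        proof (rule less.hyps)
          show "?f j \<in> wt_space (- h - j)" by (rule exp_L1_pow_L0_weight(1)[OF less.prems(1)])
        qed (use False j that less.prems(2) in auto)
        then show ?thesis by (simp add: algebra_simps)
      qed
      have "star_mode sV Y \<omega> YW v ?m \<alpha> = (\<lambda>w. 0)"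
        using less.prems by (intro star[of v h]) auto
      then have "0 = star_mode sV Y \<omega> YW v ?m \<alpha> w"
        by (simp only:)
      also have "\<dots> = \<alpha> (Sum_any ?g)"
        by (simp add: star_mode_def Y_inverse_coeff_def)
      also have "\<dots> = Sum_any (\<lambda>j. \<alpha> (?g j))"
        by (rule linear_Sum_any[OF \<alpha> fin])
      also have "\<dots> = \<alpha> (?g (- 2 * h))"
        by (rule Sum_any_single) (rule vanish)
      also have "?g (- 2 * h) = sW ((-1) powi h) (YW v (- k) w)"
        unfolding exp_L1_pow_L0_weight(2)[OF less.prems(1)]
        by (simp add: linear_scale[OF module_linear_left])
      also have "\<alpha> \<dots> = (-1) powi h * \<alpha> (YW v (- k) w)"
        by (rule linear_scale[OF \<alpha>])
      finally show ?thesis by simp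
    qed
  qed
qed

section \<open>Equality of the two spaces of functionals\<close>

lemma Z_dual_eq:
  assumes n: "n \<ge> 1"
  shows "Z_dual sW YW n =
           {\<alpha> \<in> full_dual sW. \<forall>h. \<forall>v \<in> wt_space h. \<forall>m \<ge> 2 * h + n - 2.
              star_mode sV Y \<omega> YW v m \<alpha> = (\<lambda>w. 0)}" (is "_ = ?R")
proof
  show "Z_dual sW YW n \<subseteq> ?R"
  proof
    fix \<alpha> assume \<alpha>: "\<alpha> \<in> Z_dual sW YW n"
    have "star_mode sV Y \<omega> YW v m \<alpha> = (\<lambda>w. 0)"
      if "v \<in> wt_space h" "m \<ge> 2 * h + n - 2" for h v m
      using that
      by (intro star_mode_Z_dual[OF n \<alpha>])
        (auto simp: homogeneous_component_weight[OF that(1)] split: if_splits)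
    then show "\<alpha> \<in> ?R" using \<alpha> by (auto simp: Z_dual_def)
  qed
  show "?R \<subseteq> Z_dual sW YW n"
  proof
    fix \<alpha> assume R: "\<alpha> \<in> ?R"
    then have \<alpha>: "Vector_Spaces.linear sW (*) \<alpha>" by (simp add: full_dual_def)
    then interpret \<alpha>: Vector_Spaces.linear sW "(*)" \<alpha> .
    have gen: "\<alpha> (YW v (- n) w) = 0" for v w
    proof -
      \<comment> \<open>C_n(W) is generated by modes of arbitrary vectors, so \<open>v\<close> is
        split into homogeneous components.\<close>
      let ?c = "\<lambda>h. homogeneous_component sV Y \<omega> h v"
      have c: "\<And>h. ?c h \<in> wt_space h" "finite {h. ?c h \<noteq> 0}" "Sum_any ?c = v"
        using homogeneous_decomposition_component[of v]
        by (auto simp: homogeneous_decomposition_def)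
      have "Vector_Spaces.linear sV (*) (\<lambda>v. \<alpha> (YW v (- n) w))"
        using Vector_Spaces.linear_compose[OF module_linear_left \<alpha>] by (simp add: o_def)
      from linear_Sum_any[OF this c(2)]
      have "\<alpha> (YW v (- n) w) = Sum_any (\<lambda>h. \<alpha> (YW (?c h) (- n) w))"
        by (simp only: c(3))
      also have "\<dots> = 0"
        using annihilates_homogeneous_modes[OF \<alpha> _ c(1), of n n] R by simp
      finally show ?thesis .
    qed
    have "\<alpha> w = 0" if "w \<in> C_space sW YW n" for w
      using that gen \<alpha>.eq_0_on_span[of "{YW v (- n) w | v w. True}" w]
      unfolding C_space_def by blast
    then show "\<alpha> \<in> Z_dual sW YW n" using R by (simp add: Z_dual_def)
  qed
qed

end

theorem proposition3p6:
  fixes sV :: "complex \<Rightarrow> 'v::ab_group_add \<Rightarrow> 'v"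
    and Y :: "'v \<Rightarrow> int \<Rightarrow> 'v \<Rightarrow> 'v"
    and vac \<omega> :: 'v
    and c :: complex
    and sW :: "complex \<Rightarrow> 'w::ab_group_add \<Rightarrow> 'w"
    and YW :: "'v \<Rightarrow> int \<Rightarrow> 'w \<Rightarrow> 'w"
    and n :: int
  assumes "vertex_operator_algebra sV Y vac \<omega> c"
    and "weak_module sV Y vac \<omega> c sW YW"
    and "n \<ge> 2"
  shows "Z_dual sW YW n =
           {\<alpha> \<in> full_dual sW.
              \<forall>h. \<forall>v \<in> weight_space sV Y \<omega> h. \<forall>m \<ge> 2 * h + n - 2.
                star_mode sV Y \<omega> YW v m \<alpha> = (\<lambda>w. 0)}
         \<and> Z_dual sW YW n \<subseteq> D_space sV Y \<omega> sW YW"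
proof -
  interpret weak_module sV Y vac \<omega> c sW YW by fact
  show ?thesis
    using Z_dual_eq[of n] Z_dual_subset_D_space[of n] assms(3) by simp
qed

end
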